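(* Let $F$ be $\mathbb{R}$ or $\mathbb{C}$, let $n,n'$ be fixed nonnegative integers, and let $\rho\ge 1$ be a fixed real number. Write $\|\cdot\|=\|\cdot\|_\rho$. 1. For all nonnegative integers $p,p'$, all $A,B\in M_{n,n'}(p,p';F)$ and all $\lambda\in F$: (a) $\|A\|=0$ if and only if $A=0$; (b) $\|\lambda A\|=|\lambda|\,\|A\|$; (c) $\|A+B\|\le \|A\|+\|B\|$. 2. For any nonnegative integers $p,p',q,q'$ there is a positive number $\lambda(p,p',q,q')$ such that for all $A\in M_{n,n'}(p,p';F)$ and $B\in M_{n,n'}(q,q';F)$ $$\lambda(p,p',q,q')\,\|A\|\,\|B\|\le \|A\bigodot B\|\le \|A\|\,\|B\|.$$
   Context: For a nonnegative integer $n$, $I_n$ denotes the set of row $n$-tuples $\alpha=(\alpha_1,\dots,\alpha_n)$ of nonnegative integers ($I_0=\{0\}$); $|\alpha|=\alpha_1+\dots+\alpha_n$, $\alpha!=\alpha_1!\cdots\alpha_n!$; $\beta\ll\alpha$ means $\beta_i\le\alpha_i$ for all $i$, and then $\binom{\alpha}{\beta}=\frac{\alpha!}{\beta!(\alpha-\beta)!}$. $M_{n,n'}(p,p';F)$ is the set of matrices $A=(A_{\alpha,\alpha'})$ with entries in $F$, rows indexed by $\alpha\in I_n$ with $|\alpha|=p$ and columns indexed by $\alpha'\in I_{n'}$ with $|\alpha'|=p'$. For $A\in M_{n,n'}(p,p';F)$ and $B\in M_{n,n'}(q,q';F)$, the product $A\bigodot B\in M_{n,n'}(p+q,p'+q';F)$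 is defined by $$(A\bigodot B)_{\alpha,\alpha'}=\sum_{\beta,\beta'}\binom{\alpha}{\beta}A_{\beta,\beta'}B_{\alpha-\beta,\alpha'-\beta'},$$ the sum being over all $\beta\in I_n$, $\beta'\in I_{n'}$ with $|\beta|=p$, $|\beta'|=p'$, $\beta\ll\alpha$, $\beta'\ll\alpha'$. For $A\in M_{n,n'}(p,p';F)$ the $\rho$-norm is $$\|A\|_\rho=\Big(\sum_{\alpha,\alpha'}\frac{|A_{\alpha,\alpha'}|^{\rho}}{\alpha!\,(p!\,p'!)^{\rho-1}}\Big)^{1/\rho}.$$ *)

theory Defs
  imports Complex_Main
begin

(* A multi-index in I_n is a function vanishing from position n on, so that
   equality, the componentwise order and componentwise subtraction are those of
   the function type. For n = 0 only the zero function is left. *)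
type_synonym multi_index = "nat \<Rightarrow> nat"

definition multi_indices :: "nat \<Rightarrow> multi_index set" where
  "multi_indices n = {\<alpha>. \<forall>i\<ge>n. \<alpha> i = 0}"

definition mi_size :: "nat \<Rightarrow> multi_index \<Rightarrow> nat" where
  "mi_size n \<alpha> = (\<Sum>i<n. \<alpha> i)"

definition mi_fact :: "nat \<Rightarrow> multi_index \<Rightarrow> nat" where
  "mi_fact n \<alpha> = (\<Prod>i<n. fact (\<alpha> i))"

definition mi_choose :: "nat \<Rightarrow> multi_index \<Rightarrow> multi_index \<Rightarrow> 'a::field_char_0" where
  "mi_choose n \<alpha> \<beta> =
     of_nat (mi_fact n \<alpha>) / (of_nat (mi_fact n \<beta>) * of_nat (mi_fact n (\<alpha> - \<beta>)))"

definition mi_of_size :: "nat \<Rightarrow> nat \<Rightarrow> multi_index set" where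
  "mi_of_size n p = {\<alpha> \<in> multi_indices n. mi_size n \<alpha> = p}"

(* Entries outside the index range are fixed to be 0, so that equality of
   matrices is equality of functions. The index range may be empty
   (n = 0 and p > 0); the zero matrix is then the only one. *)
type_synonym 'a mi_matrix = "multi_index \<Rightarrow> multi_index \<Rightarrow> 'a"

definition mi_matrices :: "nat \<Rightarrow> nat \<Rightarrow> nat \<Rightarrow> nat \<Rightarrow> 'a::zero mi_matrix set" where
  "mi_matrices n n' p p' =
     {A. \<forall>\<alpha> \<alpha>'. \<not> (\<alpha> \<in> mi_of_size n p \<and> \<alpha>' \<in> mi_of_size n' p') \<longrightarrow> A \<alpha> \<alpha>' = 0}"

definition mi_prod ::
    "nat \<Rightarrow> nat \<Rightarrow> nat \<Rightarrow> nat \<Rightarrow> nat \<Rightarrow> nat \<Rightarrow> 'a mi_matrix \<Rightarrow> 'a mi_matrix \<Rightarrow> 'a::field_char_0 mi_matrix"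
  where
  "mi_prod n n' p p' q q' A B = (\<lambda>\<alpha> \<alpha>'.
     if \<alpha> \<in> mi_of_size n (p + q) \<and> \<alpha>' \<in> mi_of_size n' (p' + q')
     then \<Sum>\<beta> | \<beta> \<in> mi_of_size n p \<and> \<beta> \<le> \<alpha>. \<Sum>\<beta>' | \<beta>' \<in> mi_of_size n' p' \<and> \<beta>' \<le> \<alpha>'.
            mi_choose n \<alpha> \<beta> * A \<beta> \<beta>' * B (\<alpha> - \<beta>) (\<alpha>' - \<beta>')
     else 0)"

definition rho_norm ::
    "real \<Rightarrow> nat \<Rightarrow> nat \<Rightarrow> nat \<Rightarrow> nat \<Rightarrow> 'a::real_normed_field mi_matrix \<Rightarrow> real" where
  "rho_norm \<rho> n n' p p' A =
     (\<Sum>\<alpha>\<in>mi_of_size n p. \<Sum>\<alpha>'\<in>mi_of_size n' p'.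
        norm (A \<alpha> \<alpha>') powr \<rho>
          / (real (mi_fact n \<alpha>) * (fact p * fact p') powr (\<rho> - 1))) powr (1 / \<rho>)"

end

theory Submission
  imports Defs "HOL-Analysis.Convex" "HOL-Library.Function_Algebras"
    "HOL-Computational_Algebra.Fundamental_Theorem_Algebra"
begin

text \<open>
  The \<open>\<rho>\<close>-norm is a weighted \<open>\<ell>\<^sup>\<rho>\<close>-norm on the finite-dimensional space of matrices: the weight
  of the entry at \<open>(\<alpha>, \<alpha>')\<close> is \<open>1 / (\<alpha>! (p! p'!)\<^bsup>\<rho> - 1\<^esup>)\<close>. The norm axioms are therefore those of weighted
  \<open>\<ell>\<^sup>\<rho>\<close>-norms, where the triangle inequality comes from the convexity of \<open>x powr \<rho>\<close> on
  \<open>x \<ge> 0\<close> (\<open>wnorm_triangle\<close>).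

  The upper bound (\<open>rho_norm_mi_prod_le\<close>) comes from the same convexity. An entry of the
  product is rewritten as a sum with the weights
  \<open>mi_choose n \<alpha> \<beta> * mi_choose n' \<alpha>' \<beta>'\<close>, whose total is, by Vandermonde's identity for
  multi-indices (\<open>sum_mi_choose\<close>), the number \<open>(p + q choose p) * (p' + q' choose p')\<close>. Taking
  the power \<open>\<rho>\<close> inside the sum costs the power \<open>\<rho> - 1\<close> of that number, and this is exactly what turns the
  factor \<open>((p + q)! (p' + q')!)\<^bsup>\<rho> - 1\<^esup>\<close> in the weight of the product into the factors of the two weights.

  For the lower bound, a matrix \<open>A\<close> is read as the polynomial with coefficients
  \<open>A \<alpha> \<alpha>' / \<alpha>!\<close> in \<open>n + n'\<close> variables; the product of matrices becomes the product of
  polynomials, and the norm for the exponent \<open>1\<close> becomes the sum of the absolute values of the coefficients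
  (the length of the polynomial). Kronecker's substitution, which replaces the \<open>i\<close>-th
  variable by \<open>X ^ (D ^ i)\<close> for a large \<open>D\<close>, makes the polynomials univariate without merging
  coefficients (\<open>mi_poly_mi_prod\<close>, \<open>poly_length_mi_poly\<close>). Over \<open>\<complex>\<close> one factor then splits into
  linear factors, and multiplying by \<open>X - r\<close> changes the length by the factor
  \<open>1 + norm r\<close>, up to constants that depend on the degree only. This gives an explicit
  \<open>K\<close> with \<open>poly_length P * poly_length Q \<le> K * poly_length (P * Q)\<close>
  (\<open>poly_length_mult_ge\<close>). The equivalence of the norms for the exponents \<open>\<rho>\<close> and \<open>1\<close> transfers the
  bound to every \<open>\<rho>\<close>, and real matrices are complex matrices with the same norms and products.
\<close>

section \<open>Weighted norms with exponent at least one\<close>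

text \<open>
  \<open>powr_convex\<close> covers two positive points; if one of them is \<open>0\<close>, the claim reduces
  to \<open>s powr p \<le> s\<close> for \<open>0 < s < 1\<close>.
\<close>

lemma convex_on_powr_atLeast:
  assumes "p \<ge> 1"
  shows "convex_on {0..} (\<lambda>x::real. x powr p)"
proof (rule convex_onI)
  fix t x y :: real
  assume t: "0 < t" "t < 1" and x: "x \<in> {0..}" and y: "y \<in> {0..}"
  have shrink: "(s * z) powr p \<le> s * z powr p" if "0 < s" "s < 1" "0 \<le> z" for s z :: real
  proof -
    have "s powr p \<le> s powr 1"
      using that assms by (intro powr_mono') auto
    with that show ?thesis
      by (simp add: powr_mult mult_right_mono)
  qed
  consider "x = 0" | "y = 0" | "x > 0" "y > 0"
    using x y by fastforce
  then show "((1 - t) *\<^sub>R x + t *\<^sub>R y) powr p \<le> (1 - t) * x powr p + t * y powr p"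
  proof cases
    case 1
    then show ?thesis using shrink[of t y] t y by simp
  next
    case 2
    then show ?thesis using shrink[of "1 - t" x] t x by simp
  next
    case 3
    then show ?thesis
      using convex_onD[OF powr_convex[OF assms], of t x y] t by simp
  qed
qed (rule convex_real_interval)

text \<open>
  The weighted power mean inequality: Jensen's inequality for \<open>x powr \<rho>\<close> with the weights
  normalised to total \<open>1\<close>, cleared of the normalisation.
\<close>

lemma powr_weighted_sum_le:
  fixes w x :: "'b \<Rightarrow> real"
  assumes "finite S" and "\<rho> \<ge> 1"
    and w: "\<And>s. s \<in> S \<Longrightarrow> w s \<ge> 0" and x: "\<And>s. s \<in> S \<Longrightarrow> x s \<ge> 0"
  shows "(\<Sum>s\<in>S. w s * x s) powr \<rho> \<le> (\<Sum>s\<in>S. w s) powr (\<rho> - 1) * (\<Sum>s\<in>S. w s * x s powr \<rho>)"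
proof (cases "(\<Sum>s\<in>S. w s) = 0")
  case True
  then have "\<forall>s\<in>S. w s = 0"
    using \<open>finite S\<close> w by (simp add: sum_nonneg_eq_0_iff)
  then show ?thesis by simp
next
  case False
  define W where "W = (\<Sum>s\<in>S. w s)"
  have W: "W > 0"
    using False w unfolding W_def by (simp add: order_less_le sum_nonneg)
  have "(\<Sum>s\<in>S. (w s / W) *\<^sub>R x s) powr \<rho> \<le> (\<Sum>s\<in>S. w s / W * x s powr \<rho>)"
  proof (rule convex_on_sum[OF \<open>finite S\<close> _ convex_on_powr_atLeast[OF \<open>\<rho> \<ge> 1\<close>]])
    show "S \<noteq> {}" using False by auto
    show "(\<Sum>s\<in>S. w s / W) = 1"
      using W by (simp add: W_def flip: sum_divide_distrib)
  qed (use w x W in auto)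
  moreover have "(\<Sum>s\<in>S. (w s / W) *\<^sub>R x s) = (\<Sum>s\<in>S. w s * x s) / W"
    by (simp add: sum_divide_distrib)
  moreover have "(\<Sum>s\<in>S. w s / W * x s powr \<rho>) = (\<Sum>s\<in>S. w s * x s powr \<rho>) / W"
    by (simp add: sum_divide_distrib)
  ultimately have "(\<Sum>s\<in>S. w s * x s) powr \<rho> / W powr \<rho> \<le> (\<Sum>s\<in>S. w s * x s powr \<rho>) / W"
    using W w x by (simp add: powr_divide sum_nonneg)
  then have "(\<Sum>s\<in>S. w s * x s) powr \<rho> \<le> W powr \<rho> / W * (\<Sum>s\<in>S. w s * x s powr \<rho>)"
    using W by (simp add: field_simps)
  also have "W powr \<rho> / W = W powr (\<rho> - 1)"
    using W by (simp add: powr_diff)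
  finally show ?thesis by (simp add: W_def)
qed

definition wnorm :: "real \<Rightarrow> 'b set \<Rightarrow> ('b \<Rightarrow> real) \<Rightarrow> ('b \<Rightarrow> 'a::real_normed_vector) \<Rightarrow> real" where
  "wnorm \<rho> S w f = (\<Sum>s\<in>S. w s * norm (f s) powr \<rho>) powr (1 / \<rho>)"

lemma wnorm_nonneg: "wnorm \<rho> S w f \<ge> 0"
  by (simp add: wnorm_def)

lemma wnorm_powr:
  assumes "\<rho> \<ge> 1" and "\<And>s. s \<in> S \<Longrightarrow> w s \<ge> 0"
  shows "wnorm \<rho> S w f powr \<rho> = (\<Sum>s\<in>S. w s * norm (f s) powr \<rho>)"
  using assms by (simp add: wnorm_def powr_powr sum_nonneg)

lemma wnorm_cong:
  assumes "\<And>s. s \<in> S \<Longrightarrow> norm (f s) = norm (g s)"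
  shows "wnorm \<rho> S w f = wnorm \<rho> S w g"
  using assms by (simp add: wnorm_def)

lemma wnorm_eq_0_iff:
  assumes "finite S" "\<And>s. s \<in> S \<Longrightarrow> w s > 0"
  shows "wnorm \<rho> S w f = 0 \<longleftrightarrow> (\<forall>s\<in>S. f s = 0)"
proof -
  have "wnorm \<rho> S w f = 0 \<longleftrightarrow> (\<Sum>s\<in>S. w s * norm (f s) powr \<rho>) = 0"
    by (simp add: wnorm_def)
  also have "\<dots> \<longleftrightarrow> (\<forall>s\<in>S. w s * norm (f s) powr \<rho> = 0)"
    using assms by (intro sum_nonneg_eq_0_iff) (auto simp: less_imp_le)
  also have "\<dots> \<longleftrightarrow> (\<forall>s\<in>S. f s = 0)"
    using assms(2) by force
  finally show ?thesis .
qed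

lemma wnorm_mult:
  fixes c :: "'a::real_normed_field"
  assumes "\<rho> \<ge> 1"
  shows "wnorm \<rho> S w (\<lambda>s. c * f s) = norm c * wnorm \<rho> S w f"
proof -
  have "(\<Sum>s\<in>S. w s * norm (c * f s) powr \<rho>) = norm c powr \<rho> * (\<Sum>s\<in>S. w s * norm (f s) powr \<rho>)"
    by (simp add: norm_mult powr_mult sum_distrib_left mult_ac)
  then show ?thesis
    using assms by (simp add: wnorm_def powr_mult powr_powr)
qed

lemma wnorm_le_iff:
  assumes "\<rho> \<ge> 1" "\<And>s. s \<in> S \<Longrightarrow> w s \<ge> 0" "0 \<le> M"
  shows "wnorm \<rho> S w f \<le> M \<longleftrightarrow> (\<Sum>s\<in>S. w s * norm (f s) powr \<rho>) \<le> M powr \<rho>"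
proof -
  have "wnorm \<rho> S w f \<le> M \<longleftrightarrow> wnorm \<rho> S w f powr \<rho> \<le> M powr \<rho>"
    using assms wnorm_nonneg by (metis less_eq_real_def not_less powr_less_mono2 powr_mono2 zero_less_one order_less_le_trans)
  then show ?thesis using assms by (simp add: wnorm_powr)
qed

text \<open>
  Minkowski's inequality. With \<open>a\<close> and \<open>b\<close> the norms of \<open>f\<close> and \<open>g\<close>, the sum \<open>f + g\<close> is
  \<open>a + b\<close> times a convex combination of the normalised functions \<open>f / a\<close> and \<open>g / b\<close>, and convexity
  of \<open>x powr \<rho>\<close> shows that such a combination has norm at most \<open>1\<close>.
\<close>

lemma wnorm_triangle:
  assumes "finite S" and "\<rho> \<ge> 1" and w: "\<And>s. s \<in> S \<Longrightarrow> w s > 0"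
  shows "wnorm \<rho> S w (\<lambda>s. f s + g s) \<le> wnorm \<rho> S w f + wnorm \<rho> S w g"
proof -
  define a b where "a = wnorm \<rho> S w f" and "b = wnorm \<rho> S w g"
  note zero_iff = wnorm_eq_0_iff[OF \<open>finite S\<close> w, where \<rho> = \<rho>]
  consider "a = 0" | "b = 0" | "a > 0" "b > 0"
    using wnorm_nonneg[of \<rho> S w f] wnorm_nonneg[of \<rho> S w g] unfolding a_def b_def by linarith
  then show ?thesis
  proof cases
    case 1
    then have "wnorm \<rho> S w (\<lambda>s. f s + g s) = b"
      unfolding b_def using zero_iff[where f = f] by (intro wnorm_cong) (simp add: a_def)
    with 1 show ?thesis by (simp add: a_def b_def)
  next
    case 2
    then have "wnorm \<rho> S w (\<lambda>s. f s + g s) = a"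
      unfolding a_def using zero_iff[where f = g] by (intro wnorm_cong) (simp add: b_def)
    with 2 show ?thesis by (simp add: a_def b_def)
  next
    case 3
    \<comment> \<open>the weight of \<open>g / b\<close>; the weight of \<open>f / a\<close> is \<open>1 - t = a / (a + b)\<close>\<close>
    define t where "t = b / (a + b)"
    have t: "0 \<le> t" "t \<le> 1" "1 - t = a / (a + b)"
      using 3 by (auto simp: t_def field_simps)
    have point: "norm (f s + g s) powr \<rho>
        \<le> (a + b) powr \<rho> * ((1 - t) * (norm (f s) powr \<rho> / a powr \<rho>) + t * (norm (g s) powr \<rho> / b powr \<rho>))" for s
    proof -
      have "norm (f s + g s) \<le> norm (f s) + norm (g s)"
        by (rule norm_triangle_ineq)
      also have "\<dots> = (a + b) * ((1 - t) * (norm (f s) / a) + t * (norm (g s) / b))"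
      proof -
        have "(a + b) * ((1 - t) * (norm (f s) / a) + t * (norm (g s) / b))
            = ((a + b) * (1 - t)) * (norm (f s) / a) + ((a + b) * t) * (norm (g s) / b)"
          by (simp only: distrib_left mult.assoc)
        also have "(a + b) * (1 - t) = a"
          using 3 unfolding t(3) by simp
        also have "(a + b) * t = b"
          using 3 by (simp add: t_def)
        finally show ?thesis
          using 3 by simp
      qed
      finally have "norm (f s + g s) powr \<rho>
          \<le> ((a + b) * ((1 - t) * (norm (f s) / a) + t * (norm (g s) / b))) powr \<rho>"
        using \<open>\<rho> \<ge> 1\<close> by (intro powr_mono2) auto
      also have "\<dots> = (a + b) powr \<rho> * ((1 - t) * (norm (f s) / a) + t * (norm (g s) / b)) powr \<rho>"
        using 3 t by (intro powr_mult)
      also have "((1 - t) * (norm (f s) / a) + t * (norm (g s) / b)) powr \<rho>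
          \<le> (1 - t) * (norm (f s) / a) powr \<rho> + t * (norm (g s) / b) powr \<rho>"
        using convex_onD[OF convex_on_powr_atLeast[OF \<open>\<rho> \<ge> 1\<close>], of t "norm (f s) / a" "norm (g s) / b"] 3 t
        by simp
      finally show ?thesis
        using 3 by (simp add: powr_divide mult_left_mono)
    qed
    have "(\<Sum>s\<in>S. w s * norm (f s + g s) powr \<rho>)
        \<le> (\<Sum>s\<in>S. w s * ((a + b) powr \<rho> * ((1 - t) * (norm (f s) powr \<rho> / a powr \<rho>) + t * (norm (g s) powr \<rho> / b powr \<rho>))))"
      using w point by (intro sum_mono mult_left_mono) (auto simp: less_imp_le)
    also have "\<dots> = (a + b) powr \<rho> * ((1 - t) * ((\<Sum>s\<in>S. w s * norm (f s) powr \<rho>) / a powr \<rho>)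
        + t * ((\<Sum>s\<in>S. w s * norm (g s) powr \<rho>) / b powr \<rho>))"
      by (simp add: sum.distrib sum_distrib_left sum_divide_distrib algebra_simps)
    also have "\<dots> = (a + b) powr \<rho>"
    proof -
      have "(\<Sum>s\<in>S. w s * norm (f s) powr \<rho>) = a powr \<rho>" "(\<Sum>s\<in>S. w s * norm (g s) powr \<rho>) = b powr \<rho>"
        unfolding a_def b_def using w by (auto intro!: wnorm_powr[OF \<open>\<rho> \<ge> 1\<close>, symmetric] less_imp_le)
      then show ?thesis using 3 by simp
    qed
    finally show ?thesis
      using 3 \<open>\<rho> \<ge> 1\<close> w by (subst wnorm_le_iff) (auto simp: a_def b_def less_imp_le)
  qed
qed

text \<open>
  Each single entry is bounded by a multiple of any of these norms, and each of them is monotone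
  in the absolute values of the entries. So on a finite index set any two of them with positive weights bound each
  other up to constants.
\<close>

lemma wnorm_equivalence:
  assumes "finite S" and "\<rho> \<ge> 1" "\<sigma> \<ge> 1"
    and w: "\<And>s. s \<in> S \<Longrightarrow> w s \<ge> 0" and v: "\<And>s. s \<in> S \<Longrightarrow> v s > 0"
  shows "\<exists>c>0. \<forall>f :: 'b \<Rightarrow> 'a::real_normed_vector. wnorm \<rho> S w f \<le> c * wnorm \<sigma> S v f"
proof -
  define k where "k s = inverse (v s) powr (1 / \<sigma>)" for s
  \<comment> \<open>the summand \<open>1\<close> keeps the constant positive when all weights vanish\<close>
  define C where "C = 1 + (\<Sum>s\<in>S. w s * k s powr \<rho>)"
  have C: "C > 0"
    using w by (simp add: C_def add_pos_nonneg sum_nonneg)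
  have bound: "wnorm \<rho> S w f \<le> C powr (1 / \<rho>) * wnorm \<sigma> S v f" for f :: "'b \<Rightarrow> 'a"
  proof -
    define T where "T = wnorm \<sigma> S v f"
    have T: "T \<ge> 0" by (simp add: T_def wnorm_nonneg)
    have entry: "norm (f s) \<le> k s * T" if "s \<in> S" for s
    proof -
      have "v s * norm (f s) powr \<sigma> \<le> T powr \<sigma>"
        using that v unfolding T_def
        by (subst wnorm_powr[OF \<open>\<sigma> \<ge> 1\<close>])
           (auto intro!: member_le_sum[where f = "\<lambda>s. v s * norm (f s) powr \<sigma>"] \<open>finite S\<close> simp: less_imp_le)
      then have "norm (f s) powr \<sigma> \<le> inverse (v s) * T powr \<sigma>"
        using v[OF that] by (simp add: field_simps)
      then have "(norm (f s) powr \<sigma>) powr (1 / \<sigma>) \<le> (inverse (v s) * T powr \<sigma>) powr (1 / \<sigma>)"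
        using \<open>\<sigma> \<ge> 1\<close> by (intro powr_mono2) auto
      then show ?thesis
        using \<open>\<sigma> \<ge> 1\<close> T v[OF that] by (simp add: powr_mult powr_powr k_def)
    qed
    have "(\<Sum>s\<in>S. w s * norm (f s) powr \<rho>) \<le> (\<Sum>s\<in>S. w s * (k s * T) powr \<rho>)"
      using entry w \<open>\<rho> \<ge> 1\<close> by (intro sum_mono mult_left_mono powr_mono2) auto
    also have "\<dots> = (\<Sum>s\<in>S. w s * k s powr \<rho>) * T powr \<rho>"
      using T by (simp add: powr_mult sum_distrib_left k_def mult_ac)
    also have "\<dots> \<le> C * T powr \<rho>"
      by (intro mult_right_mono) (auto simp: C_def)
    also have "\<dots> = (C powr (1 / \<rho>) * T) powr \<rho>"
      using C T \<open>\<rho> \<ge> 1\<close> by (simp add: powr_mult powr_powr)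
    finally show ?thesis
      using T w \<open>\<rho> \<ge> 1\<close> by (subst wnorm_le_iff) (auto simp: T_def)
  qed
  moreover have "C powr (1 / \<rho>) > 0"
    using C by simp
  ultimately show ?thesis by blast
qed

section \<open>Multi-indices and binomial coefficients\<close>

lemma mi_of_size_iff: "\<alpha> \<in> mi_of_size n p \<longleftrightarrow> (\<forall>i\<ge>n. \<alpha> i = 0) \<and> (\<Sum>i<n. \<alpha> i) = p"
  by (simp add: mi_of_size_def multi_indices_def mi_size_def)

lemma mi_of_size_entry_le:
  assumes "\<alpha> \<in> mi_of_size n p"
  shows "\<alpha> i \<le> p"
proof (cases "i < n")
  case True
  then have "\<alpha> i \<le> (\<Sum>i<n. \<alpha> i)" by (intro member_le_sum) auto
  then show ?thesis using assms by (simp add: mi_of_size_iff)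
qed (use assms in \<open>simp add: mi_of_size_iff\<close>)

lemma finite_mi_of_size [simp]: "finite (mi_of_size n p)"
proof (rule finite_subset)
  show "mi_of_size n p \<subseteq> {\<alpha>. \<forall>i. (i \<in> {..<n} \<longrightarrow> \<alpha> i \<in> {..p}) \<and> (i \<notin> {..<n} \<longrightarrow> \<alpha> i = 0)}"
    using mi_of_size_entry_le by (auto simp: mi_of_size_iff)
  show "finite {\<alpha> :: nat \<Rightarrow> nat. \<forall>i. (i \<in> {..<n} \<longrightarrow> \<alpha> i \<in> {..p}) \<and> (i \<notin> {..<n} \<longrightarrow> \<alpha> i = 0)}"
    by (rule finite_set_of_finite_funs) auto
qed

lemma finite_mi_below [simp]: "finite {\<beta>. \<beta> \<in> mi_of_size n p \<and> \<beta> \<le> \<alpha>}"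
  by (rule finite_subset[OF _ finite_mi_of_size[of n p]]) auto

lemma mi_of_size_add:
  assumes "\<beta> \<in> mi_of_size n p" "\<gamma> \<in> mi_of_size n q"
  shows "\<beta> + \<gamma> \<in> mi_of_size n (p + q)"
  using assms by (simp add: mi_of_size_iff sum.distrib)

lemma mi_of_size_diff:
  assumes "\<alpha> \<in> mi_of_size n (p + q)" "\<beta> \<in> mi_of_size n p" "\<beta> \<le> \<alpha>"
  shows "\<alpha> - \<beta> \<in> mi_of_size n q"
  using assms by (simp add: mi_of_size_iff le_fun_def sum_subtractf_nat)

lemma mi_diff_add:
  fixes \<alpha> \<beta> :: multi_index
  assumes "\<beta> \<le> \<alpha>"
  shows "\<beta> + (\<alpha> - \<beta>) = \<alpha>"
  using assms by (auto simp: le_fun_def)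

text \<open>
  Convolution sums are sums over independent pairs, by the bijection
  \<open>(\<alpha>, \<beta>) \<mapsto> (\<beta>, \<alpha> - \<beta>)\<close>.
\<close>

lemma sum_mi_split:
  fixes g :: "multi_index \<Rightarrow> multi_index \<Rightarrow> 'b::comm_monoid_add"
  shows "(\<Sum>\<alpha>\<in>mi_of_size n (p + q). \<Sum>\<beta> | \<beta> \<in> mi_of_size n p \<and> \<beta> \<le> \<alpha>. g \<beta> (\<alpha> - \<beta>))
       = (\<Sum>\<beta>\<in>mi_of_size n p. \<Sum>\<gamma>\<in>mi_of_size n q. g \<beta> \<gamma>)"
proof -
  have "(\<Sum>\<alpha>\<in>mi_of_size n (p + q). \<Sum>\<beta> | \<beta> \<in> mi_of_size n p \<and> \<beta> \<le> \<alpha>. g \<beta> (\<alpha> - \<beta>))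
      = (\<Sum>(\<alpha>, \<beta>)\<in>(SIGMA \<alpha>:mi_of_size n (p + q). {\<beta>. \<beta> \<in> mi_of_size n p \<and> \<beta> \<le> \<alpha>}). g \<beta> (\<alpha> - \<beta>))"
    by (subst sum.Sigma) auto
  also have "\<dots> = (\<Sum>(\<beta>, \<gamma>)\<in>mi_of_size n p \<times> mi_of_size n q. g \<beta> \<gamma>)"
    by (rule sum.reindex_bij_witness[where i = "\<lambda>(\<beta>, \<gamma>). (\<beta> + \<gamma>, \<beta>)" and j = "\<lambda>(\<alpha>, \<beta>). (\<beta>, \<alpha> - \<beta>)"])
       (auto simp: mi_of_size_add mi_of_size_diff mi_diff_add le_fun_def)
  finally show ?thesis
    by (simp add: sum.cartesian_product)
qed

lemma sum_mi_split2:
  fixes g :: "multi_index \<Rightarrow> multi_index \<Rightarrow> multi_index \<Rightarrow> multi_index \<Rightarrow> 'b::comm_monoid_add"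
  shows "(\<Sum>\<alpha>\<in>mi_of_size n (p + q). \<Sum>\<alpha>'\<in>mi_of_size n' (p' + q').
            \<Sum>\<beta> | \<beta> \<in> mi_of_size n p \<and> \<beta> \<le> \<alpha>. \<Sum>\<beta>' | \<beta>' \<in> mi_of_size n' p' \<and> \<beta>' \<le> \<alpha>'.
              g \<beta> \<beta>' (\<alpha> - \<beta>) (\<alpha>' - \<beta>'))
       = (\<Sum>\<beta>\<in>mi_of_size n p. \<Sum>\<beta>'\<in>mi_of_size n' p'. \<Sum>\<gamma>\<in>mi_of_size n q. \<Sum>\<gamma>'\<in>mi_of_size n' q'.
              g \<beta> \<beta>' \<gamma> \<gamma>')" (is "?lhs = ?rhs")
proof -
  have "?lhs = (\<Sum>\<alpha>\<in>mi_of_size n (p + q). \<Sum>\<beta> | \<beta> \<in> mi_of_size n p \<and> \<beta> \<le> \<alpha>.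
            \<Sum>\<alpha>'\<in>mi_of_size n' (p' + q'). \<Sum>\<beta>' | \<beta>' \<in> mi_of_size n' p' \<and> \<beta>' \<le> \<alpha>'.
              g \<beta> \<beta>' (\<alpha> - \<beta>) (\<alpha>' - \<beta>'))"
    by (intro sum.cong refl sum.swap)
  also have "\<dots> = (\<Sum>\<alpha>\<in>mi_of_size n (p + q). \<Sum>\<beta> | \<beta> \<in> mi_of_size n p \<and> \<beta> \<le> \<alpha>.
            \<Sum>\<beta>'\<in>mi_of_size n' p'. \<Sum>\<gamma>'\<in>mi_of_size n' q'. g \<beta> \<beta>' (\<alpha> - \<beta>) \<gamma>')"
    by (intro sum.cong refl sum_mi_split[where g = "\<lambda>\<beta>' \<gamma>'. g _ \<beta>' _ \<gamma>'"])
  also have "\<dots> = (\<Sum>\<beta>\<in>mi_of_size n p. \<Sum>\<gamma>\<in>mi_of_size n q. \<Sum>\<beta>'\<in>mi_of_size n' p'. \<Sum>\<gamma>'\<in>mi_of_size n' q'.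
              g \<beta> \<beta>' \<gamma> \<gamma>')"
    by (rule sum_mi_split[where g = "\<lambda>\<beta> \<gamma>. \<Sum>\<beta>'\<in>mi_of_size n' p'. \<Sum>\<gamma>'\<in>mi_of_size n' q'. g \<beta> \<beta>' \<gamma> \<gamma>'"])
  also have "\<dots> = ?rhs"
    by (intro sum.cong refl sum.swap)
  finally show ?thesis .
qed

lemma mi_fact_pos [simp]: "mi_fact n \<alpha> > 0"
  by (simp add: mi_fact_def prod_pos)

lemma mi_choose_divide_fact:
  "mi_choose n \<alpha> \<beta> / of_nat (mi_fact n \<alpha>)
     = (1 / (of_nat (mi_fact n \<beta>) * of_nat (mi_fact n (\<alpha> - \<beta>))) :: 'a::field_char_0)"
proof -
  have "(of_nat (mi_fact n \<alpha>) :: 'a) \<noteq> 0"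
    using mi_fact_pos[of n \<alpha>] by (simp del: mi_fact_pos)
  then show ?thesis by (simp add: mi_choose_def)
qed

lemma mi_choose_eq_prod:
  assumes "\<beta> \<le> \<alpha>"
  shows "mi_choose n \<alpha> \<beta> = (of_nat (\<Prod>i<n. \<alpha> i choose \<beta> i) :: 'a::field_char_0)"
proof -
  have "(\<Prod>i<n. of_nat (\<alpha> i choose \<beta> i) :: 'a) = (\<Prod>i<n. fact (\<alpha> i) / (fact (\<beta> i) * fact (\<alpha> i - \<beta> i)))"
    using assms by (intro prod.cong refl binomial_fact) (auto simp: le_fun_def)
  then show ?thesis
    by (simp add: mi_choose_def mi_fact_def prod_dividef prod.distrib)
qed

lemma mi_choose_ge_1:
  assumes "\<beta> \<le> \<alpha>"
  shows "(mi_choose n \<alpha> \<beta> :: real) \<ge> 1"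
proof -
  have "(\<Prod>i<n. \<alpha> i choose \<beta> i) > 0"
    using assms by (intro prod_pos) (auto simp: le_fun_def)
  then have "1 \<le> (\<Prod>i<n. \<alpha> i choose \<beta> i)" by linarith
  then show ?thesis
    unfolding mi_choose_eq_prod[OF assms] by (metis of_nat_1 of_nat_mono)
qed

text \<open>
  Splitting off the last entry of a multi-index, for induction on the number of entries.
\<close>

lemma sum_mi_of_size_Suc:
  fixes g :: "multi_index \<Rightarrow> 'b::comm_monoid_add"
  shows "(\<Sum>\<beta>\<in>mi_of_size (Suc n) p. g \<beta>) = (\<Sum>k\<le>p. \<Sum>\<gamma>\<in>mi_of_size n (p - k). g (\<gamma>(n := k)))"
proof -
  have "(\<Sum>k\<le>p. \<Sum>\<gamma>\<in>mi_of_size n (p - k). g (\<gamma>(n := k)))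
      = (\<Sum>(k, \<gamma>)\<in>(SIGMA k:{..p}. mi_of_size n (p - k)). g (\<gamma>(n := k)))"
    by (subst sum.Sigma) auto
  also have "\<dots> = (\<Sum>\<beta>\<in>mi_of_size (Suc n) p. g \<beta>)"
    by (rule sum.reindex_bij_witness[where i = "\<lambda>\<beta>. (\<beta> n, \<beta>(n := 0))" and j = "\<lambda>(k, \<gamma>). \<gamma>(n := k)"])
       (auto simp: mi_of_size_iff fun_eq_iff)
  finally show ?thesis ..
qed

text \<open>
  Both sides count the ways to choose \<open>p\<close> elements from a disjoint union of \<open>n\<close> sets with
  \<open>\<alpha> i\<close> elements each. The sum includes \<open>\<beta>\<close> not below \<open>\<alpha>\<close>, whose terms vanish; this keeps the
  index set independent of \<open>\<alpha>\<close> in the induction.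
\<close>

lemma mi_vandermonde:
  "(\<Sum>\<beta>\<in>mi_of_size n p. \<Prod>i<n. \<alpha> i choose \<beta> i) = (\<Sum>i<n. \<alpha> i) choose p"
proof (induction n arbitrary: p)
  case 0
  have "mi_of_size 0 p = (if p = 0 then {\<lambda>_. 0} else {})"
    by (auto simp: mi_of_size_iff)
  then show ?case by simp
next
  case (Suc n)
  have "(\<Sum>\<beta>\<in>mi_of_size (Suc n) p. \<Prod>i<Suc n. \<alpha> i choose \<beta> i)
      = (\<Sum>k\<le>p. \<Sum>\<gamma>\<in>mi_of_size n (p - k). (\<Prod>i<n. \<alpha> i choose \<gamma> i) * (\<alpha> n choose k))"
    by (simp add: sum_mi_of_size_Suc)
  also have "\<dots> = (\<Sum>k\<le>p. (\<alpha> n choose k) * ((\<Sum>i<n. \<alpha> i) choose (p - k)))"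
    by (simp add: Suc.IH mult.commute flip: sum_distrib_left)
  also have "\<dots> = (\<Sum>i<Suc n. \<alpha> i) choose p"
    by (simp add: vandermonde add.commute)
  finally show ?case .
qed

lemma sum_mi_choose:
  assumes "\<alpha> \<in> mi_of_size n (p + q)"
  shows "(\<Sum>\<beta> | \<beta> \<in> mi_of_size n p \<and> \<beta> \<le> \<alpha>. mi_choose n \<alpha> \<beta>) = real (p + q choose p)"
proof -
  have "(\<Prod>i<n. \<alpha> i choose \<beta> i) = 0" if "\<beta> \<in> mi_of_size n p" "\<not> \<beta> \<le> \<alpha>" for \<beta>
  proof -
    obtain i where i: "\<alpha> i < \<beta> i"
      using \<open>\<not> \<beta> \<le> \<alpha>\<close> by (auto simp: le_fun_def not_le)
    then have "i < n"
      using that(1) by (metis mi_of_size_iff not_le not_less0)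
    with i show ?thesis by (auto intro!: bexI[of _ i] simp: prod_zero_iff)
  qed
  then have "(\<Sum>\<beta> | \<beta> \<in> mi_of_size n p \<and> \<beta> \<le> \<alpha>. \<Prod>i<n. \<alpha> i choose \<beta> i)
      = (\<Sum>\<beta>\<in>mi_of_size n p. \<Prod>i<n. \<alpha> i choose \<beta> i)"
    by (intro sum.mono_neutral_left) auto
  also have "\<dots> = (p + q choose p)"
    using assms by (simp add: mi_vandermonde mi_of_size_iff)
  finally have "real (\<Sum>\<beta> | \<beta> \<in> mi_of_size n p \<and> \<beta> \<le> \<alpha>. \<Prod>i<n. \<alpha> i choose \<beta> i) = real (p + q choose p)"
    by simp
  moreover have "(\<Sum>\<beta> | \<beta> \<in> mi_of_size n p \<and> \<beta> \<le> \<alpha>. mi_choose n \<alpha> \<beta>)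
      = real (\<Sum>\<beta> | \<beta> \<in> mi_of_size n p \<and> \<beta> \<le> \<alpha>. \<Prod>i<n. \<alpha> i choose \<beta> i)"
    unfolding of_nat_sum by (intro sum.cong refl mi_choose_eq_prod) auto
  ultimately show ?thesis by simp
qed

section \<open>The norm on matrices\<close>

definition rho_weight :: "real \<Rightarrow> nat \<Rightarrow> nat \<Rightarrow> nat \<Rightarrow> multi_index \<Rightarrow> real" where
  "rho_weight \<rho> n p p' \<alpha> = 1 / (real (mi_fact n \<alpha>) * (fact p * fact p') powr (\<rho> - 1))"

lemma rho_weight_pos: "rho_weight \<rho> n p p' \<alpha> > 0"
  by (simp add: rho_weight_def)

lemma rho_weight_nonneg [simp]: "rho_weight \<rho> n p p' \<alpha> \<ge> 0"
  by (simp add: rho_weight_def)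

lemma rho_norm_eq_wnorm:
  "rho_norm \<rho> n n' p p' A
     = wnorm \<rho> (mi_of_size n p \<times> mi_of_size n' p') (\<lambda>(\<alpha>, \<alpha>'). rho_weight \<rho> n p p' \<alpha>) (\<lambda>(\<alpha>, \<alpha>'). A \<alpha> \<alpha>')"
  by (simp add: rho_norm_def wnorm_def rho_weight_def sum.cartesian_product case_prod_unfold)

lemma rho_norm_nonneg: "rho_norm \<rho> n n' p p' A \<ge> 0"
  by (simp add: rho_norm_def)

lemma rho_norm_eq_0_iff:
  assumes "A \<in> mi_matrices n n' p p'"
  shows "rho_norm \<rho> n n' p p' A = 0 \<longleftrightarrow> A = (\<lambda>_ _. 0)"
proof -
  have "rho_norm \<rho> n n' p p' A = 0 \<longleftrightarrow> (\<forall>\<alpha>\<in>mi_of_size n p. \<forall>\<alpha>'\<in>mi_of_size n' p'. A \<alpha> \<alpha>' = 0)"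
    unfolding rho_norm_eq_wnorm by (subst wnorm_eq_0_iff) (auto simp: rho_weight_pos)
  also have "\<dots> \<longleftrightarrow> A = (\<lambda>_ _. 0)"
    using assms unfolding mi_matrices_def fun_eq_iff by auto
  finally show ?thesis .
qed

lemma rho_norm_mult:
  assumes "\<rho> \<ge> 1"
  shows "rho_norm \<rho> n n' p p' (\<lambda>\<alpha> \<alpha>'. c * A \<alpha> \<alpha>') = norm c * rho_norm \<rho> n n' p p' A"
  using wnorm_mult[OF assms, of _ _ c "\<lambda>(\<alpha>, \<alpha>'). A \<alpha> \<alpha>'"]
  by (simp add: rho_norm_eq_wnorm case_prod_unfold)

lemma rho_norm_triangle:
  assumes "\<rho> \<ge> 1"
  shows "rho_norm \<rho> n n' p p' (\<lambda>\<alpha> \<alpha>'. A \<alpha> \<alpha>' + B \<alpha> \<alpha>') \<le> rho_norm \<rho> n n' p p' A + rho_norm \<rho> n n' p p' B"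
  using wnorm_triangle[of "mi_of_size n p \<times> mi_of_size n' p'" \<rho> "\<lambda>(\<alpha>, \<alpha>'). rho_weight \<rho> n p p' \<alpha>"
      "\<lambda>(\<alpha>, \<alpha>'). A \<alpha> \<alpha>'" "\<lambda>(\<alpha>, \<alpha>'). B \<alpha> \<alpha>'"] assms
  by (simp add: rho_norm_eq_wnorm case_prod_unfold rho_weight_pos)

lemma rho_norm_equivalence:
  assumes "\<rho> \<ge> 1" "\<sigma> \<ge> 1"
  shows "\<exists>c>0. \<forall>A :: 'a::real_normed_field mi_matrix. rho_norm \<rho> n n' p p' A \<le> c * rho_norm \<sigma> n n' p p' A"
proof -
  obtain c where "c > 0" and c: "\<And>f :: multi_index \<times> multi_index \<Rightarrow> 'a.
      wnorm \<rho> (mi_of_size n p \<times> mi_of_size n' p') (\<lambda>(\<alpha>, \<alpha>'). rho_weight \<rho> n p p' \<alpha>) f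
        \<le> c * wnorm \<sigma> (mi_of_size n p \<times> mi_of_size n' p') (\<lambda>(\<alpha>, \<alpha>'). rho_weight \<sigma> n p p' \<alpha>) f"
    using wnorm_equivalence[OF _ assms, of "mi_of_size n p \<times> mi_of_size n' p'"
        "\<lambda>(\<alpha>, \<alpha>'). rho_weight \<rho> n p p' \<alpha>" "\<lambda>(\<alpha>, \<alpha>'). rho_weight \<sigma> n p p' \<alpha>", where 'a = 'a]
    by (auto simp: rho_weight_pos)
  then show ?thesis
    unfolding rho_norm_eq_wnorm by blast
qed

section \<open>Submultiplicativity\<close>

definition rho_sum :: "real \<Rightarrow> nat \<Rightarrow> nat \<Rightarrow> nat \<Rightarrow> nat \<Rightarrow> 'a::real_normed_field mi_matrix \<Rightarrow> real" where
  "rho_sum \<rho> n n' p p' A =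
     (\<Sum>\<alpha>\<in>mi_of_size n p. \<Sum>\<alpha>'\<in>mi_of_size n' p'. rho_weight \<rho> n p p' \<alpha> * norm (A \<alpha> \<alpha>') powr \<rho>)"

lemma rho_norm_eq_rho_sum: "rho_norm \<rho> n n' p p' A = rho_sum \<rho> n n' p p' A powr (1 / \<rho>)"
  by (simp add: rho_norm_def rho_sum_def rho_weight_def)

lemma rho_sum_nonneg: "rho_sum \<rho> n n' p p' A \<ge> 0"
  by (simp add: rho_sum_def sum_nonneg)

text \<open>
  The exponents of the factorials in the weights are such that the total \<open>(p + q choose p) * (p' + q' choose p')\<close>
  of the binomial weights, raised to the power \<open>\<rho> - 1\<close>, makes the weights multiplicative.
\<close>

lemma rho_weight_mult:
  "rho_weight \<rho> n (p + q) (p' + q') \<alpha>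
           * (real (p + q choose p) * real (p' + q' choose p')) powr (\<rho> - 1) * mi_choose n \<alpha> \<beta>
       = rho_weight \<rho> n p p' \<beta> * rho_weight \<rho> n q q' (\<alpha> - \<beta>)"
proof -
  have C: "real (p + q choose p) * real (p' + q' choose p') = (fact (p + q) * fact (p' + q')) / ((fact p * fact p') * (fact q * fact q'))"
    by (simp add: binomial_fact)
  have "rho_weight \<rho> n (p + q) (p' + q') \<alpha>
           * (real (p + q choose p) * real (p' + q' choose p')) powr (\<rho> - 1) * mi_choose n \<alpha> \<beta>
      = (mi_choose n \<alpha> \<beta> / real (mi_fact n \<alpha>)) / ((fact p * fact p') powr (\<rho> - 1) * (fact q * fact q') powr (\<rho> - 1))"
    unfolding C by (simp add: rho_weight_def powr_divide powr_mult)
  then show ?thesis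
    by (simp add: mi_choose_divide_fact rho_weight_def)
qed

text \<open>
  Each entry of the product is bounded by \<open>powr_weighted_sum_le\<close>. The sum in \<open>mi_prod\<close> carries only
  the factor \<open>mi_choose n \<alpha> \<beta>\<close>; the second factor \<open>mi_choose n' \<alpha>' \<beta>'\<close> of the weight is divided out of the summand
  again and enters the result with the exponent \<open>1 - \<rho> \<le> 0\<close>, so that it can be dropped because it is at least \<open>1\<close>.
\<close>

lemma rho_norm_mi_prod_le:
  fixes A B :: "'a::real_normed_field mi_matrix"
  assumes "\<rho> \<ge> 1"
  shows "rho_norm \<rho> n n' (p + q) (p' + q') (mi_prod n n' p p' q q' A B)
           \<le> rho_norm \<rho> n n' p p' A * rho_norm \<rho> n n' q q' B"
proof -
  let ?K = "real (p + q choose p) * real (p' + q' choose p')"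
  let ?below = "\<lambda>n p \<alpha>. {\<beta>. \<beta> \<in> mi_of_size n p \<and> \<beta> \<le> \<alpha>}"
  let ?g = "\<lambda>\<beta> \<beta>' \<gamma> \<gamma>'. (rho_weight \<rho> n p p' \<beta> * norm (A \<beta> \<beta>') powr \<rho>) * (rho_weight \<rho> n q q' \<gamma> * norm (B \<gamma> \<gamma>') powr \<rho>)"
  have entry: "rho_weight \<rho> n (p + q) (p' + q') \<alpha> * norm (mi_prod n n' p p' q q' A B \<alpha> \<alpha>') powr \<rho>
      \<le> (\<Sum>\<beta>\<in>?below n p \<alpha>. \<Sum>\<beta>'\<in>?below n' p' \<alpha>'. ?g \<beta> \<beta>' (\<alpha> - \<beta>) (\<alpha>' - \<beta>'))"
    if \<alpha>: "\<alpha> \<in> mi_of_size n (p + q)" and \<alpha>': "\<alpha>' \<in> mi_of_size n' (p' + q')" for \<alpha> \<alpha>'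
  proof -
    define S where "S = ?below n p \<alpha> \<times> ?below n' p' \<alpha>'"
    define w where "w = (\<lambda>(\<beta>, \<beta>'). mi_choose n \<alpha> \<beta> * mi_choose n' \<alpha>' \<beta>' :: real)"
    define y where "y = (\<lambda>(\<beta>, \<beta>'). norm (A \<beta> \<beta>') * norm (B (\<alpha> - \<beta>) (\<alpha>' - \<beta>')))"
    define x where "x = (\<lambda>s. y s / mi_choose n' \<alpha>' (snd s))"
    have choose_pos: "(mi_choose n \<alpha> \<beta> :: real) > 0" if "\<beta> \<le> \<alpha>" for n \<alpha> \<beta>
      using mi_choose_ge_1[OF that, of n] by linarith
    have S: "finite S" "\<And>s. s \<in> S \<Longrightarrow> fst s \<le> \<alpha> \<and> snd s \<le> \<alpha>'"
      by (auto simp: S_def)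
    have w: "w s \<ge> 0" and x: "x s \<ge> 0" if "s \<in> S" for s
      using S(2)[OF that] choose_pos[of "fst s" \<alpha> n] choose_pos[of "snd s" \<alpha>' n']
      by (simp_all add: w_def x_def y_def case_prod_unfold)
    have sum_w: "(\<Sum>s\<in>S. w s) = ?K"
    proof -
      have "(\<Sum>s\<in>S. w s) = (\<Sum>\<beta>\<in>?below n p \<alpha>. mi_choose n \<alpha> \<beta>) * (\<Sum>\<beta>'\<in>?below n' p' \<alpha>'. mi_choose n' \<alpha>' \<beta>')"
        by (simp add: S_def w_def sum_product flip: sum.cartesian_product)
      then show ?thesis
        by (simp only: sum_mi_choose[OF \<alpha>] sum_mi_choose[OF \<alpha>'])
    qed
    have norm_choose: "norm (mi_choose n \<alpha> \<beta> :: 'a) = mi_choose n \<alpha> \<beta>" if "\<beta> \<le> \<alpha>" for \<beta>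
      by (simp add: mi_choose_eq_prod[OF that] del: of_nat_prod)
    have "norm (mi_prod n n' p p' q q' A B \<alpha> \<alpha>')
        = norm (\<Sum>(\<beta>, \<beta>')\<in>S. mi_choose n \<alpha> \<beta> * A \<beta> \<beta>' * B (\<alpha> - \<beta>) (\<alpha>' - \<beta>'))"
      using \<alpha> \<alpha>' by (simp add: mi_prod_def S_def sum.cartesian_product)
    also have "\<dots> \<le> (\<Sum>s\<in>S. w s * x s)"
      using S(2) choose_pos
      by (intro sum_norm_le) (auto simp: w_def x_def y_def norm_mult norm_choose less_imp_neq[symmetric])
    finally have "norm (mi_prod n n' p p' q q' A B \<alpha> \<alpha>') powr \<rho> \<le> (\<Sum>s\<in>S. w s * x s) powr \<rho>"
      using \<open>\<rho> \<ge> 1\<close> by (intro powr_mono2) auto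
    also have "\<dots> \<le> (\<Sum>s\<in>S. w s) powr (\<rho> - 1) * (\<Sum>s\<in>S. w s * x s powr \<rho>)"
      by (rule powr_weighted_sum_le[OF S(1) \<open>\<rho> \<ge> 1\<close> w x])
    also have "(\<Sum>s\<in>S. w s * x s powr \<rho>) \<le> (\<Sum>s\<in>S. mi_choose n \<alpha> (fst s) * y s powr \<rho>)"
    proof (rule sum_mono)
      fix s assume s: "s \<in> S"
      define c where "c = (mi_choose n' \<alpha>' (snd s) :: real)"
      have c: "c \<ge> 1"
        unfolding c_def using S(2)[OF s] by (intro mi_choose_ge_1) auto
      have "c * x s powr \<rho> = c powr (1 - \<rho>) * y s powr \<rho>"
        using c by (simp add: x_def powr_divide powr_diff y_def case_prod_unfold flip: c_def)
      also have "\<dots> \<le> y s powr \<rho>"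
        using c \<open>\<rho> \<ge> 1\<close> powr_mono[of "1 - \<rho>" 0 c] by (intro mult_left_le_one_le) auto
      finally have "mi_choose n \<alpha> (fst s) * (c * x s powr \<rho>) \<le> mi_choose n \<alpha> (fst s) * y s powr \<rho>"
        using S(2)[OF s] choose_pos by (intro mult_left_mono) (auto intro: less_imp_le)
      then show "w s * x s powr \<rho> \<le> mi_choose n \<alpha> (fst s) * y s powr \<rho>"
        by (simp add: w_def c_def case_prod_unfold mult_ac)
    qed
    finally have "norm (mi_prod n n' p p' q q' A B \<alpha> \<alpha>') powr \<rho>
        \<le> ?K powr (\<rho> - 1) * (\<Sum>s\<in>S. mi_choose n \<alpha> (fst s) * y s powr \<rho>)"
      by (simp add: sum_w mult_left_mono)
    then have "rho_weight \<rho> n (p + q) (p' + q') \<alpha> * norm (mi_prod n n' p p' q q' A B \<alpha> \<alpha>') powr \<rho>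
        \<le> rho_weight \<rho> n (p + q) (p' + q') \<alpha> * (?K powr (\<rho> - 1) * (\<Sum>s\<in>S. mi_choose n \<alpha> (fst s) * y s powr \<rho>))"
      by (intro mult_left_mono) auto
    also have "\<dots> = (\<Sum>s\<in>S. rho_weight \<rho> n (p + q) (p' + q') \<alpha> * ?K powr (\<rho> - 1) * mi_choose n \<alpha> (fst s) * y s powr \<rho>)"
      by (simp only: sum_distrib_left mult.assoc)
    also have "\<dots> = (\<Sum>s\<in>S. ?g (fst s) (snd s) (\<alpha> - fst s) (\<alpha>' - snd s))"
    proof (rule sum.cong[OF refl])
      fix s assume s: "s \<in> S"
      have "rho_weight \<rho> n (p + q) (p' + q') \<alpha> * ?K powr (\<rho> - 1) * mi_choose n \<alpha> (fst s)
          = rho_weight \<rho> n p p' (fst s) * rho_weight \<rho> n q q' (\<alpha> - fst s)"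
        by (rule rho_weight_mult)
      then show "rho_weight \<rho> n (p + q) (p' + q') \<alpha> * ?K powr (\<rho> - 1) * mi_choose n \<alpha> (fst s) * y s powr \<rho>
          = ?g (fst s) (snd s) (\<alpha> - fst s) (\<alpha>' - snd s)"
        by (simp add: y_def case_prod_unfold powr_mult mult_ac)
    qed
    finally show ?thesis
      by (simp add: S_def sum.cartesian_product case_prod_unfold)
  qed
  have "rho_sum \<rho> n n' (p + q) (p' + q') (mi_prod n n' p p' q q' A B)
      \<le> (\<Sum>\<alpha>\<in>mi_of_size n (p + q). \<Sum>\<alpha>'\<in>mi_of_size n' (p' + q').
          \<Sum>\<beta>\<in>?below n p \<alpha>. \<Sum>\<beta>'\<in>?below n' p' \<alpha>'. ?g \<beta> \<beta>' (\<alpha> - \<beta>) (\<alpha>' - \<beta>'))"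
    unfolding rho_sum_def by (intro sum_mono entry)
  also have "\<dots> = (\<Sum>\<beta>\<in>mi_of_size n p. \<Sum>\<beta>'\<in>mi_of_size n' p'. \<Sum>\<gamma>\<in>mi_of_size n q. \<Sum>\<gamma>'\<in>mi_of_size n' q'. ?g \<beta> \<beta>' \<gamma> \<gamma>')"
    by (rule sum_mi_split2)
  also have "\<dots> = rho_sum \<rho> n n' p p' A * rho_sum \<rho> n n' q q' B"
    unfolding rho_sum_def by (simp only: sum_distrib_right) (simp only: sum_distrib_left)
  finally have "rho_sum \<rho> n n' (p + q) (p' + q') (mi_prod n n' p p' q q' A B) powr (1 / \<rho>)
      \<le> (rho_sum \<rho> n n' p p' A * rho_sum \<rho> n n' q q' B) powr (1 / \<rho>)"
    using \<open>\<rho> \<ge> 1\<close> rho_sum_nonneg by (intro powr_mono2) auto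
  then show ?thesis
    by (simp add: rho_norm_eq_rho_sum powr_mult rho_sum_nonneg)
qed

section \<open>Lengths of univariate polynomials\<close>

definition poly_length :: "'a::real_normed_field poly \<Rightarrow> real" where
  "poly_length P = (\<Sum>i\<le>degree P. norm (coeff P i))"

lemma poly_length_eq:
  assumes "degree P \<le> N"
  shows "poly_length P = (\<Sum>i\<le>N. norm (coeff P i))"
  unfolding poly_length_def
  using assms by (intro sum.mono_neutral_left) (auto simp: coeff_eq_0)

lemma poly_length_nonneg: "poly_length P \<ge> 0"
  by (simp add: poly_length_def sum_nonneg)

lemma poly_length_smult: "poly_length (smult c P) = norm c * poly_length P"
  by (subst poly_length_eq[where N = "degree P"])
     (auto simp: poly_length_def norm_mult sum_distrib_left degree_smult_le)

lemma poly_length_const: "poly_length [:c:] = norm c"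
  by (simp add: poly_length_def)

lemma poly_length_sum_monom:
  assumes "finite S" and "inj_on c S"
  shows "poly_length (\<Sum>s\<in>S. monom (f s) (c s)) = (\<Sum>s\<in>S. norm (f s))"
proof -
  let ?P = "\<Sum>s\<in>S. monom (f s) (c s)"
  have coeff: "coeff ?P (c s) = f s" if "s \<in> S" for s
  proof -
    have "coeff ?P (c s) = (\<Sum>t\<in>S. if t = s then f t else 0)"
      unfolding coeff_sum using that \<open>inj_on c S\<close>
      by (intro sum.cong) (auto dest: inj_onD)
    with that \<open>finite S\<close> show ?thesis by simp
  qed
  define N where "N = Max (insert (degree ?P) (c ` S))"
  have N: "degree ?P \<le> N" "c ` S \<subseteq> {..N}"
    using \<open>finite S\<close> by (auto simp: N_def)
  have "poly_length ?P = (\<Sum>i\<le>N. norm (coeff ?P i))"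
    by (rule poly_length_eq[OF N(1)])
  also have "\<dots> = (\<Sum>i\<in>c ` S. norm (coeff ?P i))"
    using N(2) by (intro sum.mono_neutral_right) (auto simp: coeff_sum intro!: sum.neutral)
  also have "\<dots> = (\<Sum>s\<in>S. norm (f s))"
    using \<open>inj_on c S\<close> by (simp add: sum.reindex coeff)
  finally show ?thesis .
qed

lemma poly_length_linear_mult_le:
  "poly_length ([:- r, 1:] * P) \<le> (1 + norm r) * poly_length P"
proof -
  let ?N = "degree P"
  have deg: "degree ([:- r, 1:] * P) \<le> Suc ?N"
    using degree_mult_le[of "[:- r, 1:]" P] by simp
  have "poly_length ([:- r, 1:] * P) = (\<Sum>i\<le>Suc ?N. norm (coeff ([:- r, 1:] * P) i))"
    by (rule poly_length_eq[OF deg])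
  also have "\<dots> \<le> (\<Sum>i\<le>Suc ?N. norm r * norm (coeff P i) + norm (coeff (pCons 0 P) i))"
  proof (rule sum_mono)
    fix i
    show "norm (coeff ([:- r, 1:] * P) i) \<le> norm r * norm (coeff P i) + norm (coeff (pCons 0 P) i)"
      using norm_triangle_ineq4[of "coeff (pCons 0 P) i" "r * coeff P i"] by (simp add: norm_mult)
  qed
  also have "\<dots> = norm r * (\<Sum>i\<le>Suc ?N. norm (coeff P i)) + (\<Sum>i\<le>Suc ?N. norm (coeff (pCons 0 P) i))"
    by (simp only: sum.distrib sum_distrib_left)
  also have "(\<Sum>i\<le>Suc ?N. norm (coeff P i)) = poly_length P"
    by (simp add: poly_length_eq[of P "Suc ?N"])
  also have "(\<Sum>i\<le>Suc ?N. norm (coeff (pCons 0 P) i)) = poly_length P"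
    by (simp only: sum.atMost_Suc_shift) (simp add: poly_length_def)
  finally show ?thesis
    by (simp add: algebra_simps)
qed

text \<open>
  Let \<open>R = (X - r) P\<close>. The relation \<open>R\<^sub>k\<^sub>+\<^sub>1 = P\<^sub>k - r P\<^sub>k\<^sub>+\<^sub>1\<close> can be solved for the coefficients of
  \<open>P\<close> in two directions. Downwards from the leading coefficient it multiplies errors by \<open>r\<close>, which is harmless
  if \<open>norm r \<le> 1\<close>; upwards from the constant coefficient it divides by \<open>r\<close>, which is
  harmless otherwise and gains the factor \<open>norm r\<close>.
\<close>

lemma poly_length_linear_mult_ge:
  fixes P :: "'a::real_normed_field poly"
  shows "(1 + norm r) * poly_length P \<le> 2 * real (degree P + 1) * poly_length ([:- r, 1:] * P)"
proof -
  define R where "R = [:- r, 1:] * P"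
  define N where "N = Suc (degree P)"
  have R_0: "coeff R 0 = - r * coeff P 0" and R_Suc: "coeff R (Suc k) = coeff P k - r * coeff P (Suc k)" for k
    by (simp_all add: R_def)
  have lenR: "poly_length R = (\<Sum>i\<le>N. norm (coeff R i))"
    using degree_mult_le[of "[:- r, 1:]" P] by (intro poly_length_eq) (simp add: R_def N_def)
  have coeff_bound: "(1 + norm r) * norm (coeff P k) \<le> 2 * poly_length R" if "k \<le> degree P" for k
  proof (cases "norm r \<le> 1")
    case True
    have "norm (coeff P k) \<le> (\<Sum>i\<in>{k<..N}. norm (coeff R i))" if "k \<le> N" for k
      using that
    proof (induction k rule: inc_induct)
      case base
      show ?case by (simp add: N_def coeff_eq_0)
    next
      case (step k)
      have "norm (coeff P k) \<le> norm (coeff R (Suc k)) + norm r * norm (coeff P (Suc k))"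
        using norm_triangle_ineq[of "coeff R (Suc k)" "r * coeff P (Suc k)"] by (simp add: R_Suc norm_mult)
      also have "\<dots> \<le> norm (coeff R (Suc k)) + norm (coeff P (Suc k))"
        using True by (simp add: mult_left_le_one_le)
      also have "\<dots> \<le> norm (coeff R (Suc k)) + (\<Sum>i\<in>{Suc k<..N}. norm (coeff R i))"
        using step.IH by simp
      also have "\<dots> = (\<Sum>i\<in>insert (Suc k) {Suc k<..N}. norm (coeff R i))"
        by simp
      also have "insert (Suc k) {Suc k<..N} = {k<..N}"
        using step.hyps by auto
      finally show ?case .
    qed
    also have "(\<Sum>i\<in>{k<..N}. norm (coeff R i)) \<le> poly_length R" for k
      unfolding lenR by (intro sum_mono2) auto
    finally have le: "norm (coeff P k) \<le> poly_length R"
      using \<open>k \<le> degree P\<close> by (simp add: N_def)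
    have "norm r * norm (coeff P k) \<le> norm (coeff P k)"
      using True by (simp add: mult_left_le_one_le)
    with le show ?thesis by (simp add: algebra_simps)
  next
    case False
    have "norm r * norm (coeff P k) \<le> (\<Sum>i\<le>k. norm (coeff R i))" for k
    proof (induction k)
      case 0
      show ?case by (simp add: R_0 norm_mult)
    next
      case (Suc k)
      have "norm r * norm (coeff P (Suc k)) \<le> norm (coeff R (Suc k)) + norm (coeff P k)"
        using norm_triangle_ineq4[of "coeff P k" "coeff R (Suc k)"] by (simp add: R_Suc norm_mult)
      also have "norm (coeff P k) \<le> norm r * norm (coeff P k)"
        using False by (simp add: mult_le_cancel_right1)
      also note Suc.IH
      finally show ?case by simp
    qed
    also have "(\<Sum>i\<le>k. norm (coeff R i)) \<le> poly_length R"
      unfolding lenR using that by (intro sum_mono2) (auto simp: N_def)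
    finally have le: "norm r * norm (coeff P k) \<le> poly_length R" .
    have "norm (coeff P k) \<le> norm r * norm (coeff P k)"
      using False by (simp add: mult_le_cancel_right1)
    with le show ?thesis by (simp add: algebra_simps)
  qed
  have "(1 + norm r) * poly_length P = (\<Sum>k\<le>degree P. (1 + norm r) * norm (coeff P k))"
    by (simp add: poly_length_def sum_distrib_left)
  also have "\<dots> \<le> (\<Sum>k\<le>degree P. 2 * poly_length R)"
    using coeff_bound by (intro sum_mono) auto
  finally show ?thesis
    by (simp add: R_def algebra_simps)
qed

text \<open>
  Roots of \<open>Q\<close> are moved one at a time from \<open>Q\<close> into the product: \<open>poly_length_linear_mult_le\<close>
  splits off the factor \<open>1 + norm r\<close>, and \<open>poly_length_linear_mult_ge\<close> absorbs it
  into the length of the product.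
\<close>

lemma poly_length_mult_ge:
  fixes P Q :: "complex poly"
  assumes "degree P + degree Q \<le> N"
  shows "poly_length P * poly_length Q \<le> (2 * real (N + 1)) ^ degree Q * poly_length (P * Q)"
  using assms
proof (induction "degree Q" arbitrary: Q)
  case 0
  then obtain c where "Q = [:c:]" by (metis degree_0_id of_nat_0 degree_eq_zeroE)
  then show ?case
    by (simp add: poly_length_const poly_length_smult)
next
  case (Suc m)
  have "\<not> constant (poly Q)"
    using Suc.hyps(2) by (simp add: constant_degree)
  then obtain r where "poly Q r = 0"
    using fundamental_theorem_of_algebra by blast
  then obtain Q' where Q: "Q = [:- r, 1:] * Q'"
    by (metis poly_eq_0_iff_dvd dvdE)
  have "Q' \<noteq> 0"
    using Suc.hyps(2) Q by auto
  then have deg: "degree Q = Suc (degree Q')"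
    unfolding Q by (subst degree_mult_eq) auto
  have degP: "degree (P * Q') + 1 \<le> N + 1"
    using degree_mult_le[of P Q'] Suc.prems deg by linarith
  have "poly_length P * poly_length Q \<le> (1 + norm r) * (poly_length P * poly_length Q')"
    using mult_left_mono[OF poly_length_linear_mult_le[of r Q'] poly_length_nonneg[of P]]
    by (simp add: Q mult_ac)
  also have "\<dots> \<le> (1 + norm r) * ((2 * real (N + 1)) ^ degree Q' * poly_length (P * Q'))"
    using Suc.hyps Suc.prems deg by (intro mult_left_mono) auto
  also have "\<dots> = (2 * real (N + 1)) ^ degree Q' * ((1 + norm r) * poly_length (P * Q'))"
    by (simp only: mult_ac)
  also have "\<dots> \<le> (2 * real (N + 1)) ^ degree Q' * (2 * real (degree (P * Q') + 1) * poly_length ([:- r, 1:] * (P * Q')))"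
    by (intro mult_left_mono poly_length_linear_mult_ge) auto
  also have "\<dots> \<le> (2 * real (N + 1)) ^ degree Q' * (2 * real (N + 1) * poly_length ([:- r, 1:] * (P * Q')))"
    using degP by (intro mult_left_mono mult_right_mono poly_length_nonneg) auto
  also have "[:- r, 1:] * (P * Q') = P * Q"
    by (simp only: Q mult_ac)
  finally show ?case
    by (simp only: deg power_Suc mult_ac)
qed

section \<open>Kronecker substitution\<close>

text \<open>
  The exponent that the monomial with the exponents \<open>\<alpha>\<close> receives under Kronecker's substitution.
\<close>

definition mi_code :: "nat \<Rightarrow> nat \<Rightarrow> multi_index \<Rightarrow> nat" where
  "mi_code D n \<alpha> = (\<Sum>i<n. \<alpha> i * D ^ i)"

lemma mi_code_add: "mi_code D n (\<alpha> + \<beta>) = mi_code D n \<alpha> + mi_code D n \<beta>"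
  by (simp add: mi_code_def sum.distrib distrib_right)

lemma mi_code_less:
  assumes "\<And>i. \<alpha> i < D"
  shows "mi_code D n \<alpha> < D ^ n"
proof (induction n)
  case (Suc n)
  have "mi_code D (Suc n) \<alpha> < D ^ n + \<alpha> n * D ^ n"
    using Suc by (simp add: mi_code_def)
  also have "\<dots> = Suc (\<alpha> n) * D ^ n" by simp
  also have "\<dots> \<le> D * D ^ n"
    using assms[of n] by (intro mult_right_mono) auto
  finally show ?case by simp
qed (simp add: mi_code_def)

lemma add_mult_eq_imp_eq:
  fixes a b c d m :: nat
  assumes "a + m * b = c + m * d" "a < m" "c < m"
  shows "a = c \<and> b = d"
proof -
  have "(a + m * b) mod m = a" "(a + m * b) div m = b" "(c + m * d) mod m = c" "(c + m * d) div m = d"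
    using assms(2,3) by auto
  with assms(1) show ?thesis by metis
qed

lemma mi_code_inject:
  assumes "\<And>i. \<alpha> i < D" "\<And>i. \<beta> i < D" "mi_code D n \<alpha> = mi_code D n \<beta>" "i < n"
  shows "\<alpha> i = \<beta> i"
  using assms(3,4)
proof (induction n)
  case (Suc n)
  have "mi_code D n \<alpha> + D ^ n * \<alpha> n = mi_code D n \<beta> + D ^ n * \<beta> n"
    using Suc.prems(1) by (simp add: mi_code_def mult.commute)
  then have "mi_code D n \<alpha> = mi_code D n \<beta> \<and> \<alpha> n = \<beta> n"
    by (rule add_mult_eq_imp_eq) (simp_all add: mi_code_less assms(1,2))
  with Suc show ?case by (auto simp: less_Suc_eq)
qed simp

text \<open>
  The digits of \<open>\<alpha>'\<close> are placed above the \<open>n\<close> digits of \<open>\<alpha>\<close>, so that all \<open>n + n'\<close> variables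
  take part in one substitution.
\<close>

definition mi_code2 :: "nat \<Rightarrow> nat \<Rightarrow> nat \<Rightarrow> multi_index \<Rightarrow> multi_index \<Rightarrow> nat" where
  "mi_code2 D n n' \<alpha> \<alpha>' = mi_code D n \<alpha> + D ^ n * mi_code D n' \<alpha>'"

lemma mi_code2_add:
  "mi_code2 D n n' (\<alpha> + \<beta>) (\<alpha>' + \<beta>') = mi_code2 D n n' \<alpha> \<alpha>' + mi_code2 D n n' \<beta> \<beta>'"
  by (simp add: mi_code2_def mi_code_add algebra_simps)

text \<open>
  No two monomials of bidegree \<open>(p, p')\<close> are merged: their entries are at most \<open>p\<close> and \<open>p'\<close>, hence
  digits in base \<open>D\<close>, and a number determines its digits.
\<close>

lemma inj_on_mi_code2:
  assumes "p < D" "p' < D"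
  shows "inj_on (\<lambda>(\<alpha>, \<alpha>'). mi_code2 D n n' \<alpha> \<alpha>') (mi_of_size n p \<times> mi_of_size n' p')"
proof (rule inj_onI, clarify)
  fix \<alpha> \<alpha>' \<beta> \<beta>'
  assume *: "\<alpha> \<in> mi_of_size n p" "\<alpha>' \<in> mi_of_size n' p'" "\<beta> \<in> mi_of_size n p" "\<beta>' \<in> mi_of_size n' p'"
    and eq: "mi_code2 D n n' \<alpha> \<alpha>' = mi_code2 D n n' \<beta> \<beta>'"
  have less: "\<alpha> i < D" "\<alpha>' i < D" "\<beta> i < D" "\<beta>' i < D" for i
    using * mi_of_size_entry_le assms by (meson le_less_trans)+
  have codes: "mi_code D n \<alpha> = mi_code D n \<beta> \<and> mi_code D n' \<alpha>' = mi_code D n' \<beta>'"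
    using eq unfolding mi_code2_def by (rule add_mult_eq_imp_eq) (simp_all add: mi_code_less less)
  then have "\<alpha> i = \<beta> i" if "i < n" for i
    using that mi_code_inject[of \<alpha> D \<beta> n i] less by simp
  moreover have "\<alpha>' i = \<beta>' i" if "i < n'" for i
    using that mi_code_inject[of \<alpha>' D \<beta>' n' i] less codes by simp
  ultimately show "\<alpha> = \<beta> \<and> \<alpha>' = \<beta>'"
    using * unfolding mi_of_size_iff fun_eq_iff by (metis not_le)
qed

text \<open>
  The division by \<open>\<alpha>!\<close> absorbs the binomial coefficients in \<open>mi_prod\<close>; there is no
  division by \<open>\<alpha>'!\<close> because \<open>mi_prod\<close> has binomial coefficients for the row indices only.
\<close>

definition mi_poly :: "nat \<Rightarrow> nat \<Rightarrow> nat \<Rightarrow> nat \<Rightarrow> nat \<Rightarrow> 'a::field_char_0 mi_matrix \<Rightarrow> 'a poly" where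
  "mi_poly D n n' p p' A = (\<Sum>\<alpha>\<in>mi_of_size n p. \<Sum>\<alpha>'\<in>mi_of_size n' p'.
     monom (A \<alpha> \<alpha>' / of_nat (mi_fact n \<alpha>)) (mi_code2 D n n' \<alpha> \<alpha>'))"

lemma mi_poly_mi_prod:
  "mi_poly D n n' (p + q) (p' + q') (mi_prod n n' p p' q q' A B)
     = mi_poly D n n' p p' A * mi_poly D n n' q q' B"
proof -
  let ?below = "\<lambda>n p \<alpha>. {\<beta>. \<beta> \<in> mi_of_size n p \<and> \<beta> \<le> \<alpha>}"
  let ?g = "\<lambda>\<beta> \<beta>' \<gamma> \<gamma>'. monom (A \<beta> \<beta>' / of_nat (mi_fact n \<beta>)) (mi_code2 D n n' \<beta> \<beta>')
      * monom (B \<gamma> \<gamma>' / of_nat (mi_fact n \<gamma>)) (mi_code2 D n n' \<gamma> \<gamma>')"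
  have "monom (mi_prod n n' p p' q q' A B \<alpha> \<alpha>' / of_nat (mi_fact n \<alpha>)) (mi_code2 D n n' \<alpha> \<alpha>')
      = (\<Sum>\<beta>\<in>?below n p \<alpha>. \<Sum>\<beta>'\<in>?below n' p' \<alpha>'. ?g \<beta> \<beta>' (\<alpha> - \<beta>) (\<alpha>' - \<beta>'))"
    if "\<alpha> \<in> mi_of_size n (p + q)" "\<alpha>' \<in> mi_of_size n' (p' + q')" for \<alpha> \<alpha>'
  proof -
    have "monom (mi_choose n \<alpha> \<beta> * A \<beta> \<beta>' * B (\<alpha> - \<beta>) (\<alpha>' - \<beta>') / of_nat (mi_fact n \<alpha>)) (mi_code2 D n n' \<alpha> \<alpha>')
        = ?g \<beta> \<beta>' (\<alpha> - \<beta>) (\<alpha>' - \<beta>')" if "\<beta> \<le> \<alpha>" "\<beta>' \<le> \<alpha>'" for \<beta> \<beta>'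
    proof -
      have "mi_choose n \<alpha> \<beta> * A \<beta> \<beta>' * B (\<alpha> - \<beta>) (\<alpha>' - \<beta>') / of_nat (mi_fact n \<alpha>)
          = (mi_choose n \<alpha> \<beta> / of_nat (mi_fact n \<alpha>)) * (A \<beta> \<beta>' * B (\<alpha> - \<beta>) (\<alpha>' - \<beta>'))"
        by simp
      also have "\<dots> = (A \<beta> \<beta>' / of_nat (mi_fact n \<beta>)) * (B (\<alpha> - \<beta>) (\<alpha>' - \<beta>') / of_nat (mi_fact n (\<alpha> - \<beta>)))"
        by (simp add: mi_choose_divide_fact)
      finally show ?thesis
        using mi_code2_add[of D n n' \<beta> "\<alpha> - \<beta>" \<beta>' "\<alpha>' - \<beta>'"] that
        by (simp add: mult_monom mi_diff_add)
    qed
    then show ?thesis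
      using that by (simp add: mi_prod_def sum_divide_distrib monom_sum)
  qed
  then have "mi_poly D n n' (p + q) (p' + q') (mi_prod n n' p p' q q' A B)
      = (\<Sum>\<alpha>\<in>mi_of_size n (p + q). \<Sum>\<alpha>'\<in>mi_of_size n' (p' + q').
          \<Sum>\<beta>\<in>?below n p \<alpha>. \<Sum>\<beta>'\<in>?below n' p' \<alpha>'. ?g \<beta> \<beta>' (\<alpha> - \<beta>) (\<alpha>' - \<beta>'))"
    unfolding mi_poly_def by (intro sum.cong refl) auto
  also have "\<dots> = (\<Sum>\<beta>\<in>mi_of_size n p. \<Sum>\<beta>'\<in>mi_of_size n' p'. \<Sum>\<gamma>\<in>mi_of_size n q. \<Sum>\<gamma>'\<in>mi_of_size n' q'. ?g \<beta> \<beta>' \<gamma> \<gamma>')"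
    by (rule sum_mi_split2)
  also have "\<dots> = mi_poly D n n' p p' A * mi_poly D n n' q q' B"
    unfolding mi_poly_def by (simp only: sum_distrib_right) (simp only: sum_distrib_left)
  finally show ?thesis .
qed

text \<open>
  For the exponent \<open>1\<close> the factor \<open>(p! p'!) powr (\<rho> - 1)\<close> is \<open>1\<close>, which leaves the weights
  \<open>1 / \<alpha>!\<close> that are built into the coefficients of \<open>mi_poly\<close>.
\<close>

lemma poly_length_mi_poly:
  fixes A :: "'a::real_normed_field mi_matrix"
  assumes "p < D" "p' < D"
  shows "poly_length (mi_poly D n n' p p' A) = rho_norm 1 n n' p p' A"
proof -
  have "mi_poly D n n' p p' A = (\<Sum>s\<in>mi_of_size n p \<times> mi_of_size n' p'.
      monom (case s of (\<alpha>, \<alpha>') \<Rightarrow> A \<alpha> \<alpha>' / of_nat (mi_fact n \<alpha>)) (case s of (\<alpha>, \<alpha>') \<Rightarrow> mi_code2 D n n' \<alpha> \<alpha>'))"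
    by (simp add: mi_poly_def sum.cartesian_product case_prod_unfold)
  then have "poly_length (mi_poly D n n' p p' A)
      = (\<Sum>s\<in>mi_of_size n p \<times> mi_of_size n' p'. norm (case s of (\<alpha>, \<alpha>') \<Rightarrow> A \<alpha> \<alpha>' / of_nat (mi_fact n \<alpha>)))"
    using poly_length_sum_monom[OF _ inj_on_mi_code2[OF assms]] by simp
  also have "\<dots> = rho_norm 1 n n' p p' A"
    by (simp add: rho_norm_def sum.cartesian_product case_prod_unfold norm_divide sum_nonneg)
  finally show ?thesis .
qed

lemma degree_mi_poly_le:
  assumes "p < D" "p' < D"
  shows "degree (mi_poly D n n' p p' A) \<le> D ^ n + D ^ n * D ^ n'"
  unfolding mi_poly_def
proof (intro degree_sum_le finite_mi_of_size)
  fix \<alpha> \<alpha>' assume "\<alpha> \<in> mi_of_size n p" "\<alpha>' \<in> mi_of_size n' p'"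
  then have "\<alpha> i < D" "\<alpha>' i < D" for i
    using mi_of_size_entry_le assms by (meson le_less_trans)+
  then have "mi_code D n \<alpha> < D ^ n" "mi_code D n' \<alpha>' < D ^ n'"
    by (auto intro: mi_code_less)
  then have "mi_code2 D n n' \<alpha> \<alpha>' \<le> D ^ n + D ^ n * D ^ n'"
    unfolding mi_code2_def by (intro add_mono mult_left_mono) auto
  then show "degree (monom (A \<alpha> \<alpha>' / of_nat (mi_fact n \<alpha>)) (mi_code2 D n n' \<alpha> \<alpha>')) \<le> D ^ n + D ^ n * D ^ n'"
    by (rule order_trans[OF degree_monom_le])
qed

text \<open>
  The base \<open>D\<close> has to exceed the entries of the indices of both factors and of the product.
  \<open>N\<close> bounds the sum of the degrees of the two polynomials.
\<close>

lemma rho_norm_1_mi_prod_ge: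
  "\<exists>C>0. \<forall>A B :: complex mi_matrix. rho_norm 1 n n' p p' A * rho_norm 1 n n' q q' B
      \<le> C * rho_norm 1 n n' (p + q) (p' + q') (mi_prod n n' p p' q q' A B)"
proof -
  define D where "D = p + q + p' + q' + 1"
  define N where "N = 2 * (D ^ n + D ^ n * D ^ n')"
  have le: "rho_norm 1 n n' p p' A * rho_norm 1 n n' q q' B
      \<le> (2 * real (N + 1)) ^ N * rho_norm 1 n n' (p + q) (p' + q') (mi_prod n n' p p' q q' A B)"
    for A B :: "complex mi_matrix"
  proof -
    let ?P = "mi_poly D n n' p p' A" and ?Q = "mi_poly D n n' q q' B"
    have deg: "degree ?P + degree ?Q \<le> N"
      using degree_mi_poly_le[of p D p' n n' A] degree_mi_poly_le[of q D q' n n' B]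
      by (simp add: N_def D_def)
    have "poly_length ?P * poly_length ?Q \<le> (2 * real (N + 1)) ^ degree ?Q * poly_length (?P * ?Q)"
      by (rule poly_length_mult_ge[OF deg])
    also have "\<dots> \<le> (2 * real (N + 1)) ^ N * poly_length (?P * ?Q)"
      using deg by (intro mult_right_mono power_increasing poly_length_nonneg) auto
    finally show ?thesis
      by (simp add: poly_length_mi_poly D_def flip: mi_poly_mi_prod)
  qed
  show ?thesis
    by (rule exI[of _ "(2 * real (N + 1)) ^ N"]) (use le in auto)
qed

section \<open>Lower bounds and the theorem\<close>

text \<open>
  The bound for the exponent \<open>1\<close> carries over because \<open>rho_norm_equivalence\<close> bounds the norms of the two
  factors by those for the exponent \<open>1\<close> and, in the other direction, the norm of the product from below.
\<close>

lemma rho_norm_mi_prod_ge: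
  assumes "\<rho> \<ge> 1"
  shows "\<exists>l>0. \<forall>A B :: complex mi_matrix. l * rho_norm \<rho> n n' p p' A * rho_norm \<rho> n n' q q' B
      \<le> rho_norm \<rho> n n' (p + q) (p' + q') (mi_prod n n' p p' q q' A B)"
proof -
  obtain C where C: "C > 0" "\<And>A B :: complex mi_matrix. rho_norm 1 n n' p p' A * rho_norm 1 n n' q q' B
      \<le> C * rho_norm 1 n n' (p + q) (p' + q') (mi_prod n n' p p' q q' A B)"
    using rho_norm_1_mi_prod_ge by blast
  obtain a where a: "a > 0" "\<And>A :: complex mi_matrix. rho_norm \<rho> n n' p p' A \<le> a * rho_norm 1 n n' p p' A"
    using rho_norm_equivalence[OF assms order_refl] by blast
  obtain b where b: "b > 0" "\<And>A :: complex mi_matrix. rho_norm \<rho> n n' q q' A \<le> b * rho_norm 1 n n' q q' A"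
    using rho_norm_equivalence[OF assms order_refl] by blast
  obtain c where c: "c > 0" "\<And>A :: complex mi_matrix. rho_norm 1 n n' (p + q) (p' + q') A \<le> c * rho_norm \<rho> n n' (p + q) (p' + q') A"
    using rho_norm_equivalence[OF order_refl assms] by blast
  have "rho_norm \<rho> n n' p p' A * rho_norm \<rho> n n' q q' B
      \<le> (a * b * C * c) * rho_norm \<rho> n n' (p + q) (p' + q') (mi_prod n n' p p' q q' A B)" for A B :: "complex mi_matrix"
  proof -
    let ?AB = "mi_prod n n' p p' q q' A B"
    have "rho_norm \<rho> n n' p p' A * rho_norm \<rho> n n' q q' B \<le> (a * rho_norm 1 n n' p p' A) * (b * rho_norm 1 n n' q q' B)"
      using a b by (intro mult_mono) (auto simp: rho_norm_nonneg)
    also have "\<dots> = a * b * (rho_norm 1 n n' p p' A * rho_norm 1 n n' q q' B)"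
      by (simp only: mult_ac)
    also have "\<dots> \<le> a * b * (C * (c * rho_norm \<rho> n n' (p + q) (p' + q') ?AB))"
      using a(1) b(1) C(1) order_trans[OF C(2) mult_left_mono[OF c(2)]] by (intro mult_left_mono) auto
    finally show ?thesis by (simp only: mult_ac)
  qed
  then have "1 / (a * b * C * c) * rho_norm \<rho> n n' p p' A * rho_norm \<rho> n n' q q' B
      \<le> rho_norm \<rho> n n' (p + q) (p' + q') (mi_prod n n' p p' q q' A B)" for A B :: "complex mi_matrix"
    using a(1) b(1) c(1) C(1) by (simp add: pos_divide_le_eq mult.commute)
  moreover have "1 / (a * b * C * c) > 0"
    using a(1) b(1) c(1) C(1) by simp
  ultimately show ?thesis by blast
qed

lemma rho_norm_of_real:
  "rho_norm \<rho> n n' p p' (\<lambda>\<alpha> \<alpha>'. complex_of_real (A \<alpha> \<alpha>')) = rho_norm \<rho> n n' p p' A"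
  by (simp add: rho_norm_def)

lemma mi_prod_of_real:
  "mi_prod n n' p p' q q' (\<lambda>\<alpha> \<alpha>'. complex_of_real (A \<alpha> \<alpha>')) (\<lambda>\<alpha> \<alpha>'. complex_of_real (B \<alpha> \<alpha>'))
     = (\<lambda>\<alpha> \<alpha>'. complex_of_real (mi_prod n n' p p' q q' A B \<alpha> \<alpha>'))"
  by (simp add: mi_prod_def mi_choose_def fun_eq_iff)

lemma rho_norm_mi_prod_ge_real:
  assumes "\<rho> \<ge> 1"
  shows "\<exists>l>0. \<forall>A B :: real mi_matrix. l * rho_norm \<rho> n n' p p' A * rho_norm \<rho> n n' q q' B
      \<le> rho_norm \<rho> n n' (p + q) (p' + q') (mi_prod n n' p p' q q' A B)"
  using rho_norm_mi_prod_ge[OF assms, of n n' p p' q q'] rho_norm_of_real mi_prod_of_real by metis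

theorem theorem1:
  fixes n n' :: nat and \<rho> :: real
  assumes "\<rho> \<ge> 1"
  shows
    "((\<forall>p p'. \<forall>A \<in> (mi_matrices n n' p p' :: real mi_matrix set).
          (rho_norm \<rho> n n' p p' A = 0 \<longleftrightarrow> A = (\<lambda>_ _. 0))
        \<and> (\<forall>c :: real. rho_norm \<rho> n n' p p' (\<lambda>\<alpha> \<alpha>'. c * A \<alpha> \<alpha>') = norm c * rho_norm \<rho> n n' p p' A)
        \<and> (\<forall>B \<in> (mi_matrices n n' p p' :: real mi_matrix set).
              rho_norm \<rho> n n' p p' (\<lambda>\<alpha> \<alpha>'. A \<alpha> \<alpha>' + B \<alpha> \<alpha>')
                \<le> rho_norm \<rho> n n' p p' A + rho_norm \<rho> n n' p p' B))
      \<and> (\<forall>p p' q q'. \<exists>l > 0.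
            \<forall>A \<in> (mi_matrices n n' p p' :: real mi_matrix set).
            \<forall>B \<in> (mi_matrices n n' q q' :: real mi_matrix set).
              l * rho_norm \<rho> n n' p p' A * rho_norm \<rho> n n' q q' B
                \<le> rho_norm \<rho> n n' (p + q) (p' + q') (mi_prod n n' p p' q q' A B)
            \<and> rho_norm \<rho> n n' (p + q) (p' + q') (mi_prod n n' p p' q q' A B)
                \<le> rho_norm \<rho> n n' p p' A * rho_norm \<rho> n n' q q' B))
   \<and>
     ((\<forall>p p'. \<forall>A \<in> (mi_matrices n n' p p' :: complex mi_matrix set).
          (rho_norm \<rho> n n' p p' A = 0 \<longleftrightarrow> A = (\<lambda>_ _. 0))
        \<and> (\<forall>c :: complex. rho_norm \<rho> n n' p p' (\<lambda>\<alpha> \<alpha>'. c * A \<alpha> \<alpha>') = norm c * rho_norm \<rho> n n' p p' A)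
        \<and> (\<forall>B \<in> (mi_matrices n n' p p' :: complex mi_matrix set).
              rho_norm \<rho> n n' p p' (\<lambda>\<alpha> \<alpha>'. A \<alpha> \<alpha>' + B \<alpha> \<alpha>')
                \<le> rho_norm \<rho> n n' p p' A + rho_norm \<rho> n n' p p' B))
      \<and> (\<forall>p p' q q'. \<exists>l > 0.
            \<forall>A \<in> (mi_matrices n n' p p' :: complex mi_matrix set).
            \<forall>B \<in> (mi_matrices n n' q q' :: complex mi_matrix set).
              l * rho_norm \<rho> n n' p p' A * rho_norm \<rho> n n' q q' B
                \<le> rho_norm \<rho> n n' (p + q) (p' + q') (mi_prod n n' p p' q q' A B)
            \<and> rho_norm \<rho> n n' (p + q) (p' + q') (mi_prod n n' p p' q q' A B)
                \<le> rho_norm \<rho> n n' p p' A * rho_norm \<rho> n n' q q' B))"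
proof -
  have real_bounds: "\<exists>l>0. \<forall>A \<in> (mi_matrices n n' p p' :: real mi_matrix set).
      \<forall>B \<in> (mi_matrices n n' q q' :: real mi_matrix set).
        l * rho_norm \<rho> n n' p p' A * rho_norm \<rho> n n' q q' B
          \<le> rho_norm \<rho> n n' (p + q) (p' + q') (mi_prod n n' p p' q q' A B)
        \<and> rho_norm \<rho> n n' (p + q) (p' + q') (mi_prod n n' p p' q q' A B)
          \<le> rho_norm \<rho> n n' p p' A * rho_norm \<rho> n n' q q' B" for p p' q q'
    using rho_norm_mi_prod_ge_real[OF assms, of n n' p p' q q'] rho_norm_mi_prod_le[OF assms] by blast
  have complex_bounds: "\<exists>l>0. \<forall>A \<in> (mi_matrices n n' p p' :: complex mi_matrix set).
      \<forall>B \<in> (mi_matrices n n' q q' :: complex mi_matrix set).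
        l * rho_norm \<rho> n n' p p' A * rho_norm \<rho> n n' q q' B
          \<le> rho_norm \<rho> n n' (p + q) (p' + q') (mi_prod n n' p p' q q' A B)
        \<and> rho_norm \<rho> n n' (p + q) (p' + q') (mi_prod n n' p p' q q' A B)
          \<le> rho_norm \<rho> n n' p p' A * rho_norm \<rho> n n' q q' B" for p p' q q'
    using rho_norm_mi_prod_ge[OF assms, of n n' p p' q q'] rho_norm_mi_prod_le[OF assms] by blast
  show ?thesis
    by (intro conjI allI ballI rho_norm_eq_0_iff rho_norm_mult[OF assms] rho_norm_triangle[OF assms]
        real_bounds complex_bounds)
qed

end
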